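(* Let $\mu,\pi$ be probability measures on $\mathbb{R}^d$. The entropic optimal transport problem with $\varepsilon=1$, $$\min_{\gamma\in\Gamma(\mu,\pi)}\left\{\int\tfrac12\|\mathbf{x}-\mathbf{y}\|_2^2\,d\gamma(\mathbf{x},\mathbf{y})+\varepsilon\,\mathrm{KL}(\gamma\,\|\,\mu\otimes\pi)\right\},\qquad \varepsilon=1,$$ and the static Schrödinger bridge problem with reference path measure $R=W_\mu$, $$\inf_{P}\ \mathrm{KL}(P\,\|\,R)\quad\text{such that}\quad P_0=\mu,\ P_1=\pi,$$ are the same optimization problem, up to an additive constant shift (depending only on $\mu,\pi$).
   Context: Probability measures on $\mathbb{R}^d$ are given as densities relative to Lebesgue measure. $\Gamma(\mu,\pi)$ is the set of couplings of $\mu$ and $\pi$, i.e. probability measures on $\mathbb{R}^d\times\mathbb{R}^d$ with first marginal $\mu$ and second marginal $\pi$; $\mu\otimes\pi$ is the product measure. $P$ ranges over probability measures on the space of continuous paths $[0,1]\to\mathbb{R}^d$, and $P_s$ is the law of the path at time $s$. $W_\mu=\mathbb{E}_{\mathbf{a}\sim\mu}W_{\mathbf{a}}$ is the generalized Wiener measure, where $W_{\mathbf{a}}$ is the law on $[0,1]$ of Brownian motion started at $\mathbf{a}$; that is, $W_\mu$ is the law of Brownian motion with initial law $\mu$.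
   Formalization: Adds the hypothesis that π has finite differential entropy (log of its density is π-integrable); without it the additive constant is not a real number and one problem can be finite while the other is identically +∞. *)

theory Defs
  imports "HOL-Probability.Probability"
begin

text \<open>
  The library's \<^const>\<open>KL_divergence\<close> is a Bochner integral and hence 0 when the integral diverges.
  For probability measures \<open>P \<lless> R\<close> the negative part of \<open>log (dP/dR)\<close> is always
  \<open>P\<close>-integrable, so non-integrability means that the divergence is \<open>\<infinity>\<close>.
\<close>
definition KL :: "'a measure \<Rightarrow> 'a measure \<Rightarrow> ereal" where
  "KL P R =
    (if absolutely_continuous R P \<and> integrable P (entropy_density (exp 1) R P)
     then ereal (KL_divergence (exp 1) R P) else \<infinity>)"

definition couplings :: "'a::topological_space measure \<Rightarrow> 'a measure \<Rightarrow> ('a \<times> 'a) measure set" where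
  "couplings \<mu> \<nu> =
    {\<gamma> \<in> space (prob_algebra (borel \<Otimes>\<^sub>M borel)). distr \<gamma> borel fst = \<mu> \<and> distr \<gamma> borel snd = \<nu>}"

definition eot_objective ::
    "real \<Rightarrow> (real^'d) measure \<Rightarrow> (real^'d) measure \<Rightarrow> ((real^'d) \<times> (real^'d)) measure \<Rightarrow> ereal" where
  "eot_objective \<epsilon> \<mu> \<nu> \<gamma> =
    enn2ereal (\<integral>\<^sup>+(x, y). ennreal (1/2 * (norm (x - y))\<^sup>2) \<partial>\<gamma>) + ereal \<epsilon> * KL \<gamma> (\<mu> \<Otimes>\<^sub>M \<nu>)"

text \<open>
  Continuous paths on \<open>[0,1]\<close> are represented by functions on the reals that are \<^const>\<open>undefined\<close>
  outside \<open>[0,1]\<close>. The trace of the product sigma-algebra is the Borel sigma-algebra of the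
  sup-norm topology on the space of continuous paths.
\<close>
definition path_space :: "(real \<Rightarrow> real^'d) measure" where
  "path_space = restrict_space (\<Pi>\<^sub>M t\<in>{0..1}. borel) {\<omega>. continuous_on {0..1} \<omega>}"

definition time_marginal :: "real \<Rightarrow> (real \<Rightarrow> real^'d) measure \<Rightarrow> (real^'d) measure" where
  "time_marginal s P = distr P borel (\<lambda>\<omega>. \<omega> s)"

definition endpoint_law :: "(real \<Rightarrow> real^'d) measure \<Rightarrow> ((real^'d) \<times> (real^'d)) measure" where
  "endpoint_law P = distr P (borel \<Otimes>\<^sub>M borel) (\<lambda>\<omega>. (\<omega> 0, \<omega> 1))"

definition bridges :: "(real^'d) measure \<Rightarrow> (real^'d) measure \<Rightarrow> (real \<Rightarrow> real^'d) measure set" where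
  "bridges \<mu> \<nu> =
    {P \<in> space (prob_algebra path_space). time_marginal 0 P = \<mu> \<and> time_marginal 1 P = \<nu>}"

text \<open>The centred Gaussian with covariance matrix \<open>v I\<close>; \<^const>\<open>normal_density\<close> takes the standard
  deviation.\<close>
definition isotropic_gaussian :: "real \<Rightarrow> (real^'d) measure" where
  "isotropic_gaussian v =
    density lborel (\<lambda>x. ennreal (\<Prod>i\<in>UNIV. normal_density 0 (sqrt v) (x $ i)))"

definition brownian_law :: "real^'d \<Rightarrow> (real \<Rightarrow> real^'d) measure \<Rightarrow> bool" where
  "brownian_law a W \<longleftrightarrow>
    W \<in> space (prob_algebra path_space) \<and>
    (AE \<omega> in W. \<omega> 0 = a) \<and>
    (\<forall>s t. 0 \<le> s \<and> s < t \<and> t \<le> 1 \<longrightarrow> distr W borel (\<lambda>\<omega>. \<omega> t - \<omega> s) = isotropic_gaussian (t - s)) \<and>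
    (\<forall>(n::nat) t. 0 \<le> t 0 \<and> (\<forall>i<n. t i \<le> t (Suc i)) \<and> t n \<le> 1 \<longrightarrow>
      prob_space.indep_vars W (\<lambda>_. borel) (\<lambda>i \<omega>. \<omega> (t (Suc i)) - \<omega> (t i)) {..<n})"

text \<open>The properties in \<^const>\<open>brownian_law\<close> determine \<open>W a\<close> uniquely, so at most one \<open>W\<close> is a Wiener
  kernel. For it, the generalized Wiener measure with initial law \<open>\<mu>\<close> is the mixture
  \<open>\<mu> \<bind> W\<close>.\<close>
definition wiener_kernel :: "(real^'d \<Rightarrow> (real \<Rightarrow> real^'d) measure) \<Rightarrow> bool" where
  "wiener_kernel W \<longleftrightarrow> W \<in> borel \<rightarrow>\<^sub>M prob_algebra path_space \<and> (\<forall>a. brownian_law a (W a))"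

definition minimizers :: "('a \<Rightarrow> ereal) \<Rightarrow> 'a set \<Rightarrow> 'a set" where
  "minimizers f A = {x. is_arg_min f (\<lambda>x. x \<in> A) x}"

end

theory Submission
  imports Defs
begin

text \<open>
  Let \<open>E\<close> be the endpoint law of \<open>R\<close>. A path law \<open>P \<lless> R\<close> with endpoint law \<open>\<gamma>\<close> satisfies
  \<open>KL P R = KL P Q + KL \<gamma> E\<close>, where \<open>Q\<close> is \<open>R\<close> reweighted by \<open>d\<gamma>/dE\<close> evaluated at the endpoints.
  So \<open>KL \<gamma> E\<close> is the minimum of \<open>KL P R\<close> over the path laws with endpoint law \<open>\<gamma>\<close>, and when it is
  finite only \<open>Q\<close> attains it. No disintegration of \<open>R\<close> into Brownian bridges is needed. Finally \<open>E\<close>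
  has the Gaussian density \<open>g (y - x)\<close> with respect to \<open>\<mu> \<otimes> lborel\<close>, hence \<open>\<mu> \<otimes> \<pi>\<close> has density
  \<open>p y / g (y - x)\<close> with respect to \<open>E\<close>, and \<open>KL \<gamma> E - KL \<gamma> (\<mu> \<otimes> \<pi>)\<close> is the transport cost
  plus \<open>\<integral> p log p\<close> plus \<open>d/2 log (2 pi)\<close>. All log-densities involved have integrable negative
  part, so the infinite cases match as well.
\<close>

subsection \<open>Relative entropy under densities and images\<close>

lemma ereal_add_if:
  "(if A then ereal a else \<infinity>) + (if B then ereal b else \<infinity>) =
    (if A \<and> B then ereal (a + b) else \<infinity>)"
  by auto

lemma information_space_exp: "prob_space M \<Longrightarrow> information_space M (exp 1)"
  by (simp add: information_space_def information_space_axioms_def)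

text \<open>\<open>RN_deriv\<close> is unique only up to \<open>M\<close>-null sets, which are also
  \<open>N\<close>-null. Positivity comes for free because \<open>N\<close> does not charge the zero
  set of \<open>f\<close>.\<close>

lemma entropy_density_density:
  assumes "sigma_finite_measure M" and [measurable]: "f \<in> borel_measurable M"
    and nn: "\<And>x. 0 \<le> f x" and N: "N = density M (\<lambda>x. ennreal (f x))"
  shows "AE x in N. entropy_density (exp 1) M N x = ln (f x) \<and> 0 < f x"
proof -
  interpret sigma_finite_measure M by fact
  have "AE x in M. ennreal (f x) = RN_deriv M N x"
    by (intro RN_deriv_unique) (auto simp: N)
  then have "AE x in M. 0 < f x \<longrightarrow> entropy_density (exp 1) M N x = ln (f x)"
  proof eventually_elim
    case (elim x)
    then show ?case
      by (simp add: entropy_density_def log_def nn flip: elim)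
  qed
  then show ?thesis
    by (subst N, subst AE_density) auto
qed

lemma real_density_exists:
  assumes "sigma_finite_measure M" "finite_measure N" "absolutely_continuous M N" "sets N = sets M"
  obtains f :: "'a \<Rightarrow> real" where "f \<in> borel_measurable M" "\<And>x. 0 \<le> f x"
    "N = density M (\<lambda>x. ennreal (f x))"
proof -
  interpret sigma_finite_measure M by fact
  from real_RN_deriv[OF assms(2-4)] obtain f where f: "f \<in> borel_measurable M"
    "AE x in M. RN_deriv M N x = ennreal (f x)" "\<And>x. 0 \<le> f x"
    by metis
  have "N = density M (RN_deriv M N)"
    using assms by (simp add: density_RN_deriv)
  also have "\<dots> = density M (\<lambda>x. ennreal (f x))"
    using f by (intro density_cong) auto
  finally show ?thesis
    using that f by blast
qed

text \<open>Taking u = 1/t in ln u \<le> u - 1 bounds t * max 0 (- ln t) by 1, and \<open>M\<close>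
  is finite. Hence a divergence relative to a finite measure can only fail to be finite by being
  +infinity.\<close>

lemma neg_part_ln_density_integrable:
  assumes "finite_measure M" and [measurable]: "f \<in> borel_measurable M"
    and nn: "\<And>x. 0 \<le> f x" and N: "N = density M (\<lambda>x. ennreal (f x))"
  shows "integrable N (\<lambda>x. max 0 (- ln (f x)))"
proof -
  interpret finite_measure M by fact
  have bound: "f x * max 0 (- ln (f x)) \<le> 1" for x
  proof (cases "0 < f x")
    case True
    then have "- ln (f x) \<le> inverse (f x) - 1"
      using ln_le_minus_one[of "inverse (f x)"] by (simp add: ln_inverse)
    then have "max 0 (- ln (f x)) \<le> inverse (f x)"
      using True by auto
    then have "f x * max 0 (- ln (f x)) \<le> f x * inverse (f x)"
      using True by (intro mult_left_mono) auto
    then show ?thesis using True by simp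
  next
    case False
    then show ?thesis using nn[of x] by simp
  qed
  have "integrable M (\<lambda>x. f x * max 0 (- ln (f x)))"
    by (rule integrable_const_bound[where B = 1]) (auto simp: bound nn)
  then show ?thesis
    unfolding N by (subst integrable_real_density) (auto simp: nn)
qed

lemma neg_part_entropy_density_integrable:
  assumes "finite_measure M" "finite_measure N" "absolutely_continuous M N" "sets N = sets M"
  shows "integrable N (\<lambda>x. max 0 (- entropy_density (exp 1) M N x))"
proof -
  interpret M: finite_measure M by fact
  obtain f where f[measurable]: "f \<in> borel_measurable M" and nn: "\<And>x. 0 \<le> f x"
    and N: "N = density M (\<lambda>x. ennreal (f x))"
    using real_density_exists[OF M.sigma_finite_measure_axioms assms(2-4)] by metis
  have meas: "entropy_density (exp 1) M N \<in> borel_measurable N" "f \<in> borel_measurable N"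
    using assms(4) by (simp_all cong: measurable_cong_sets)
  have "AE x in N. max 0 (- ln (f x)) = max 0 (- entropy_density (exp 1) M N x)"
    using entropy_density_density[OF M.sigma_finite_measure_axioms f nn N] by eventually_elim auto
  then show ?thesis
    using neg_part_ln_density_integrable[OF assms(1) f nn N] meas
    by (subst (asm) integrable_cong_AE) auto
qed

text \<open>Rules out cancellation of two divergent integrals: |f + g| plus the negative parts of f
  and g dominates both |f| and |g|.\<close>

lemma integrable_add_iff_neg_parts:
  fixes f g :: "'a \<Rightarrow> real"
  assumes [measurable]: "f \<in> borel_measurable M" "g \<in> borel_measurable M"
    and f: "integrable M (\<lambda>x. max 0 (- f x))" and g: "integrable M (\<lambda>x. max 0 (- g x))"
  shows "integrable M (\<lambda>x. f x + g x) \<longleftrightarrow> integrable M f \<and> integrable M g"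
proof
  assume *: "integrable M (\<lambda>x. f x + g x)"
  have "integrable M f"
    by (rule Bochner_Integration.integrable_bound[OF Bochner_Integration.integrable_add[OF
        integrable_abs[OF *] Bochner_Integration.integrable_add[OF f g]]]) auto
  moreover have "integrable M g"
    by (rule Bochner_Integration.integrable_bound[OF Bochner_Integration.integrable_add[OF
        integrable_abs[OF *] Bochner_Integration.integrable_add[OF f g]]]) auto
  ultimately show "integrable M f \<and> integrable M g" ..
qed auto

section \<open>Chain rule for relative entropy, and its nonnegativity\<close>

lemma absolutely_continuous_trans:
  "absolutely_continuous L M \<Longrightarrow> absolutely_continuous M N \<Longrightarrow> absolutely_continuous L N"
  by (auto simp: absolutely_continuous_def)

text \<open>Densities multiply, dP/dR = (dP/dQ) q, and both factors are positive
  \<open>P\<close>-almost everywhere, so the logarithms add. By \<open>neg\<close> nothing cancels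
  in the sum, so the left side is infinite exactly when one of the summands is.\<close>

lemma KL_density_chain:
  assumes "prob_space R" "prob_space Q" "prob_space P" "sets P = sets R"
    and q[measurable]: "q \<in> borel_measurable R" and nn: "\<And>x. 0 \<le> q x"
    and Q: "Q = density R (\<lambda>x. ennreal (q x))"
    and ac: "absolutely_continuous Q P"
    and neg: "integrable P (\<lambda>x. max 0 (- ln (q x)))"
  shows "KL P R = KL P Q + (if integrable P (\<lambda>x. ln (q x)) then ereal (\<integral>x. ln (q x) \<partial>P) else \<infinity>)"
proof -
  interpret R: prob_space R by fact
  interpret Q: prob_space Q by fact
  interpret P: prob_space P by fact
  have sets: "sets P = sets Q" "sets Q = sets R"
    using assms(4) by (simp_all add: Q)
  have acR: "absolutely_continuous R P"
    using absolutely_continuousI_density[of "\<lambda>x. ennreal (q x)" R] ac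
    by (auto simp: Q intro: absolutely_continuous_trans)
  obtain f where f: "f \<in> borel_measurable Q" and nnf: "\<And>x. 0 \<le> f x"
    and P: "P = density Q (\<lambda>x. ennreal (f x))"
    using real_density_exists[OF Q.sigma_finite_measure_axioms P.finite_measure_axioms ac sets(1)]
    by metis
  have f'[measurable]: "f \<in> borel_measurable R"
    using f by (simp add: Q)
  have P': "P = density R (\<lambda>x. ennreal (q x * f x))"
    unfolding P Q by (subst density_density_eq) (auto simp: nn nnf ennreal_mult)
  have ed: "AE x in P. entropy_density (exp 1) R P x = entropy_density (exp 1) Q P x + ln (q x)"
    using entropy_density_density[OF Q.sigma_finite_measure_axioms f nnf P]
      entropy_density_density[OF R.sigma_finite_measure_axioms _ _ P']
    by (auto simp: nn nnf ln_mult zero_less_mult_iff order.strict_iff_order elim!: eventually_rev_mp)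
  have [measurable]: "entropy_density (exp 1) R P \<in> borel_measurable P"
    "entropy_density (exp 1) Q P \<in> borel_measurable P" "(\<lambda>x. ln (q x)) \<in> borel_measurable P"
    using sets assms(4) by (simp_all cong: measurable_cong_sets)
  have int: "integrable P (entropy_density (exp 1) R P) \<longleftrightarrow>
      integrable P (entropy_density (exp 1) Q P) \<and> integrable P (\<lambda>x. ln (q x))"
    unfolding integrable_add_iff_neg_parts[OF _ _ neg_part_entropy_density_integrable[OF
      Q.finite_measure_axioms P.finite_measure_axioms ac sets(1)] neg, simplified, symmetric]
    using ed by (intro integrable_cong_AE) auto
  have "KL_divergence (exp 1) R P = KL_divergence (exp 1) Q P + (\<integral>x. ln (q x) \<partial>P)"
    if "integrable P (entropy_density (exp 1) Q P)" "integrable P (\<lambda>x. ln (q x))"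
  proof -
    have "KL_divergence (exp 1) R P = (\<integral>x. entropy_density (exp 1) Q P x + ln (q x) \<partial>P)"
      unfolding KL_divergence_def using ed by (intro integral_cong_AE) auto
    then show ?thesis
      using that by (simp add: KL_divergence_def)
  qed
  then show ?thesis
    unfolding KL_def by (simp add: ereal_add_if int ac acR)
qed

lemma KL_nonneg:
  assumes "prob_space R" "prob_space P" "sets P = sets R"
  shows "0 \<le> KL P R"
proof -
  interpret R: prob_space R by fact
  interpret P: prob_space P by fact
  interpret information_space R "exp 1"
    by (rule information_space_exp) fact
  show ?thesis
  proof (cases "absolutely_continuous R P \<and> integrable P (entropy_density (exp 1) R P)")
    case True
    obtain f where f[measurable]: "f \<in> borel_measurable R" and nn: "\<And>x. 0 \<le> f x"
      and P: "P = density R (\<lambda>x. ennreal (f x))"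
      using real_density_exists[OF R.sigma_finite_measure_axioms P.finite_measure_axioms _ assms(3)]
        True by metis
    have [measurable]: "entropy_density (exp 1) R P \<in> borel_measurable P" "f \<in> borel_measurable P"
      using assms(3) by (simp_all cong: measurable_cong_sets)
    have "integrable P (\<lambda>x. ln (f x))"
      using True entropy_density_density[OF R.sigma_finite_measure_axioms f nn P]
      by (subst integrable_cong_AE[where g = "entropy_density (exp 1) R P"]) auto
    then have "integrable R (\<lambda>x. f x * log (exp 1) (f x))"
      by (simp add: P integrable_real_density nn log_def)
    \<comment> \<open>\<open>KL_nonneg\<close> in the justification is the fact of the interpreted
      locale \<open>information_space\<close> about the real-valued
      \<open>KL_divergence\<close>.\<close>
    then have "0 \<le> KL_divergence (exp 1) R P"
      using \<open>prob_space P\<close> unfolding P by (intro KL_nonneg) (auto simp: nn)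
    then show ?thesis by (simp add: KL_def)
  qed (auto simp: KL_def)
qed

lemma KL_eq_0_iff:
  assumes "prob_space R" "prob_space P" "sets P = sets R"
  shows "KL P R = 0 \<longleftrightarrow> P = R"
proof -
  interpret R: prob_space R by fact
  interpret information_space R "exp 1"
    by (rule information_space_exp) fact
  have "KL_divergence (exp 1) R R = 0"
    by (rule R.KL_same_eq_0)
  \<comment> \<open>The value 0 alone could be the default of a divergent Bochner integral, so
    \<open>KL\<close> demands integrability separately. Here the density is 1 and its logarithm
    vanishes.\<close>
  moreover have "integrable R (entropy_density (exp 1) R R)"
  proof -
    have "AE x in R. entropy_density (exp 1) R R x = 0"
      using entropy_density_density[OF R.sigma_finite_measure_axioms, of "\<lambda>_. 1" R]
      by (auto simp: density_1)
    then show ?thesis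
      by (subst integrable_cong_AE[where g = "\<lambda>_. 0"]) auto
  qed
  moreover have "absolutely_continuous R R"
    by (simp add: absolutely_continuous_def)
  ultimately have "KL R R = 0"
    by (simp add: KL_def)
  then show ?thesis
    using KL_eq_0_iff_eq_ac[OF assms(2)] assms(3) by (auto simp: KL_def split: if_splits)
qed

section \<open>Reweighting a measure to a prescribed image law\<close>

lemma absolutely_continuous_distr:
  assumes "T \<in> M \<rightarrow>\<^sub>M M'" "sets N = sets M" "absolutely_continuous M N"
  shows "absolutely_continuous (distr M M' T) (distr N M' T)"
proof -
  have [measurable]: "T \<in> M \<rightarrow>\<^sub>M M'" "T \<in> N \<rightarrow>\<^sub>M M'"
    using assms(1,2) by (simp_all cong: measurable_cong_sets)
  show ?thesis
    using assms(3) sets_eq_imp_space_eq[OF assms(2)]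
    by (auto simp: absolutely_continuous_def null_sets_def emeasure_distr assms(2) subset_iff)
qed

text \<open>This is the measure Q of the overview, for a general map \<open>T\<close>.
  \<open>enn2real\<close> makes the density real-valued, as \<open>KL_density_chain\<close>
  expects.\<close>

definition tilt ::
    "'a measure \<Rightarrow> 'b measure \<Rightarrow> ('a \<Rightarrow> 'b) \<Rightarrow> 'b measure \<Rightarrow> 'a measure" where
  "tilt R S T N =
    density R (\<lambda>x. ennreal (enn2real (RN_deriv (distr R S T) N (T x))))"

context
  fixes R :: "'a measure" and S :: "'b measure" and T N
  assumes R: "prob_space R" and T[measurable]: "T \<in> R \<rightarrow>\<^sub>M S"
    and N: "prob_space N" "sets N = sets S" "absolutely_continuous (distr R S T) N"
begin

text \<open>A density that factors through \<open>T\<close> carries over to the image measure. Since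
  \<open>N\<close> is finite, the derivative is finite almost everywhere and \<open>enn2real\<close>
  does no harm.\<close>

lemma distr_tilt: "distr (tilt R S T N) S T = N"
proof -
  interpret D: prob_space "distr R S T"
    by (rule prob_space.prob_space_distr[OF R T])
  interpret N: prob_space N by (rule N)
  have [measurable]: "RN_deriv (distr R S T) N \<in> borel_measurable S"
    using borel_measurable_RN_deriv[of "distr R S T" N] by (simp del: borel_measurable_RN_deriv)
  have "distr (tilt R S T N) S T = density (distr R S T) (\<lambda>y. ennreal (enn2real (RN_deriv (distr R S T) N y)))"
    unfolding tilt_def by (subst density_distr) auto
  also have "\<dots> = density (distr R S T) (RN_deriv (distr R S T) N)"
    using D.RN_deriv_finite[OF N.sigma_finite_measure_axioms N(3)] N(2)
    by (intro density_cong) (auto elim!: eventually_mono simp: less_top)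
  also have "\<dots> = N"
    using N by (intro D.density_RN_deriv) auto
  finally show ?thesis .
qed

lemma sets_tilt: "sets (tilt R S T N) = sets R"
  by (simp add: tilt_def)

lemma prob_space_tilt: "prob_space (tilt R S T N)"
proof (rule prob_space_distrD)
  show "T \<in> tilt R S T N \<rightarrow>\<^sub>M S"
    using T by (simp add: tilt_def)
qed (simp add: distr_tilt N(1))

text \<open>The chain rule with the tilt as intermediate measure. The log-density of the tilt is a
  function of \<open>T x\<close>, so its \<open>P\<close>-integral depends only on the image law
  \<open>N\<close>, and there it is the divergence of \<open>N\<close> from the image of
  \<open>R\<close>.\<close>

lemma KL_eq_KL_tilt_add:
  assumes P: "prob_space P" "sets P = sets R" "absolutely_continuous R P" "distr P S T = N"
  shows "KL P R = KL P (tilt R S T N) + KL N (distr R S T)"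
proof -
  interpret R: prob_space R by (rule R)
  interpret P: prob_space P by (rule P)
  interpret N: prob_space N by (rule N)
  interpret D: prob_space "distr R S T"
    by (rule R.prob_space_distr) (rule T)
  let ?h = "\<lambda>y. enn2real (RN_deriv (distr R S T) N y)"
  have RN[measurable]: "RN_deriv (distr R S T) N \<in> borel_measurable S"
    using borel_measurable_RN_deriv[of "distr R S T" N] by (simp del: borel_measurable_RN_deriv)
  have TP[measurable]: "T \<in> P \<rightarrow>\<^sub>M S"
    using T P(2) by (simp cong: measurable_cong_sets)
  have ed: "entropy_density (exp 1) (distr R S T) N = (\<lambda>y. ln (?h y))"
    by (auto simp: entropy_density_def log_def)
  have Nh: "N = density (distr R S T) (\<lambda>y. ennreal (?h y))"
    using distr_tilt unfolding tilt_def by (subst density_distr) auto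
  have pos: "AE x in P. 0 < ?h (T x)"
  proof -
    have "AE y in distr P S T. 0 < ?h y"
      using entropy_density_density[OF D.sigma_finite_measure_axioms _ _ Nh]
      unfolding P(4) by (rule eventually_mono) auto
    then show ?thesis
      by (subst (asm) AE_distr_iff) simp_all
  qed
  \<comment> \<open>The density of the tilt may vanish on a set of positive
    \<open>R\<close>-measure, but by \<open>pos\<close> that set is \<open>P\<close>-null.\<close>
  have ac: "absolutely_continuous (tilt R S T N) P"
    unfolding absolutely_continuous_def
  proof
    fix A assume "A \<in> null_sets (tilt R S T N)"
    then have A: "A \<in> sets R" "AE x in R. x \<in> A \<longrightarrow> ennreal (?h (T x)) = 0"
      unfolding tilt_def by (auto simp: null_sets_density_iff)
    have "AE x in P. x \<in> A \<longrightarrow> ennreal (?h (T x)) = 0"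
      using absolutely_continuous_AE[OF P(2,3) A(2)] .
    with pos have "AE x in P. x \<notin> A"
      by eventually_elim auto
    then show "A \<in> null_sets P"
      using A P(2) by (subst AE_iff_null_sets) auto
  qed
  have "integrable N (\<lambda>y. max 0 (- ln (?h y)))"
    using neg_part_ln_density_integrable[OF D.finite_measure_axioms _ _ Nh] by simp
  then have neg: "integrable P (\<lambda>x. max 0 (- ln (?h (T x))))"
    unfolding P(4)[symmetric] by (subst (asm) integrable_distr_eq) (simp_all add: P(4))
  have "KL P R = KL P (tilt R S T N) +
      (if integrable P (\<lambda>x. ln (?h (T x))) then ereal (\<integral>x. ln (?h (T x)) \<partial>P) else \<infinity>)"
    by (rule KL_density_chain[OF R prob_space_tilt P(1,2) _ _ _ ac neg]) (auto simp: tilt_def)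
  also have "(\<lambda>x. ln (?h (T x))) = (\<lambda>x. entropy_density (exp 1) (distr R S T) N (T x))"
    by (simp add: ed)
  also have "(if integrable P \<dots> then ereal (integral\<^sup>L P \<dots>) else \<infinity>) = KL N (distr R S T)"
  proof -
    have [measurable]: "entropy_density (exp 1) (distr R S T) N \<in> borel_measurable S"
      unfolding ed by measurable
    show ?thesis
      using integrable_distr_eq[OF TP, of "entropy_density (exp 1) (distr R S T) N"]
        integral_distr[OF TP, of "entropy_density (exp 1) (distr R S T) N"] N(3)
      by (simp add: KL_def KL_divergence_def P(4))
  qed
  finally show ?thesis .
qed

text \<open>In the decomposition for the tilt itself the first summand is zero, so the tilt attains
  the lower bound given by the image laws.\<close>

lemma KL_tilt: "KL (tilt R S T N) R = KL N (distr R S T)"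
proof -
  interpret D: prob_space "distr R S T"
    by (rule prob_space.prob_space_distr[OF R T])
  have [measurable]: "RN_deriv (distr R S T) N \<in> borel_measurable S"
    using borel_measurable_RN_deriv[of "distr R S T" N] by (simp del: borel_measurable_RN_deriv)
  have "absolutely_continuous R (tilt R S T N)"
    unfolding tilt_def by (intro absolutely_continuousI_density) auto
  then have "KL (tilt R S T N) R = KL (tilt R S T N) (tilt R S T N) + KL N (distr R S T)"
    by (intro KL_eq_KL_tilt_add prob_space_tilt sets_tilt distr_tilt)
  then show ?thesis
    using KL_eq_0_iff[OF prob_space_tilt prob_space_tilt] by simp
qed

end

text \<open>The data processing inequality: drop the nonnegative first summand of the decomposition.
  Without absolute continuity the right side is infinite.\<close>

lemma KL_distr_le:
  assumes "prob_space R" "prob_space P" "sets P = sets R" "T \<in> R \<rightarrow>\<^sub>M S"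
  shows "KL (distr P S T) (distr R S T) \<le> KL P R"
proof (cases "absolutely_continuous R P")
  case True
  have T: "T \<in> P \<rightarrow>\<^sub>M S"
    using assms(3,4) by (simp cong: measurable_cong_sets)
  note N = prob_space.prob_space_distr[OF assms(2) T] sets_distr
    absolutely_continuous_distr[OF assms(4,3) True]
  show ?thesis
    using KL_eq_KL_tilt_add[OF assms(1,4) N assms(2,3) True refl]
      KL_nonneg[OF prob_space_tilt[OF assms(1,4) N] assms(2)]
    by (simp add: sets_tilt[OF assms(1,4) N] assms(3) add_increasing)
qed (simp add: KL_def)

text \<open>The equality case of data processing. Finiteness allows cancelling \<open>KL P R\<close>
  in the decomposition, leaving divergence zero between \<open>P\<close> and the tilt.\<close>

lemma KL_distr_eqD:
  assumes "prob_space R" "prob_space P" "sets P = sets R" "T \<in> R \<rightarrow>\<^sub>M S"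
    and "KL P R = KL (distr P S T) (distr R S T)" "KL P R < \<infinity>"
  shows "P = tilt R S T (distr P S T)"
proof -
  have True: "absolutely_continuous R P"
    using assms(6) by (auto simp: KL_def split: if_splits)
  have T: "T \<in> P \<rightarrow>\<^sub>M S"
    using assms(3,4) by (simp cong: measurable_cong_sets)
  note N = prob_space.prob_space_distr[OF assms(2) T] sets_distr
    absolutely_continuous_distr[OF assms(4,3) True]
  have sets: "sets P = sets (tilt R S T (distr P S T))"
    by (simp add: sets_tilt[OF assms(1,4) N] assms(3))
  have "KL P R = KL P (tilt R S T (distr P S T)) + KL P R"
    using KL_eq_KL_tilt_add[OF assms(1,4) N assms(2,3) True refl] assms(5) by simp
  moreover have "0 \<le> KL P R"
    by (rule KL_nonneg) fact+
  ultimately have "KL P (tilt R S T (distr P S T)) = 0"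
    using assms(6) by (cases "KL P R"; cases "KL P (tilt R S T (distr P S T))") auto
  then show ?thesis
    using KL_eq_0_iff[OF prob_space_tilt[OF assms(1,4) N] assms(2) sets] by simp
qed

subsection \<open>Endpoints of path measures\<close>

lemma measurable_path_eval:
  "t \<in> {0..1} \<Longrightarrow> (\<lambda>\<omega>. \<omega> t) \<in> (path_space :: (real \<Rightarrow> real^'d) measure) \<rightarrow>\<^sub>M borel"
  unfolding path_space_def by (intro measurable_restrict_space1 measurable_component_singleton)

lemma measurable_endpoints [measurable]:
  "(\<lambda>\<omega>. (\<omega> 0, \<omega> 1)) \<in> (path_space :: (real \<Rightarrow> real^'d) measure) \<rightarrow>\<^sub>M borel \<Otimes>\<^sub>M borel"
  by (intro measurable_Pair measurable_path_eval) auto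

lemma endpoint_law_marginals:
  fixes P :: "(real \<Rightarrow> real^'d) measure"
  assumes "sets P = sets path_space"
  shows "distr (endpoint_law P) borel fst = time_marginal 0 P"
    and "distr (endpoint_law P) borel snd = time_marginal 1 P"
proof -
  have [measurable]: "(\<lambda>\<omega>. (\<omega> 0, \<omega> 1)) \<in> P \<rightarrow>\<^sub>M borel \<Otimes>\<^sub>M borel"
    using measurable_endpoints assms by (simp cong: measurable_cong_sets)
  show "distr (endpoint_law P) borel fst = time_marginal 0 P"
    "distr (endpoint_law P) borel snd = time_marginal 1 P"
    unfolding endpoint_law_def time_marginal_def by (subst distr_distr; simp add: comp_def)+
qed

lemma endpoint_law_in_couplings_iff:
  fixes P :: "(real \<Rightarrow> real^'d) measure"
  assumes "P \<in> space (prob_algebra path_space)"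
  shows "endpoint_law P \<in> couplings \<mu> \<nu> \<longleftrightarrow> P \<in> bridges \<mu> \<nu>"
proof -
  have P: "sets P = sets path_space" "prob_space P"
    using assms by (auto simp: space_prob_algebra)
  have "prob_space (endpoint_law P)"
    unfolding endpoint_law_def using measurable_endpoints P
    by (intro prob_space.prob_space_distr) (simp_all cong: measurable_cong_sets)
  then show ?thesis
    using assms endpoint_law_marginals[OF P(1)]
    by (auto simp: couplings_def bridges_def space_prob_algebra) (simp_all add: endpoint_law_def)
qed

text \<open>Draw the endpoints from \<gamma> and join them by a straight segment. This provides a
  bridge also for couplings that are not absolutely continuous with respect to the endpoint law of
  the reference, where no tilt is available.\<close>

lemma exists_path_law_with_endpoints:
  fixes \<gamma> :: "((real^'d) \<times> (real^'d)) measure"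
  assumes "\<gamma> \<in> space (prob_algebra (borel \<Otimes>\<^sub>M borel))"
  obtains P where "P \<in> space (prob_algebra path_space)" "endpoint_law P = \<gamma>"
proof -
  define line :: "(real^'d) \<times> (real^'d) \<Rightarrow> real \<Rightarrow> real^'d"
    where "line = (\<lambda>z. \<lambda>t\<in>{0..1}. (1 - t) *\<^sub>R fst z + t *\<^sub>R snd z)"
  have \<gamma>: "sets \<gamma> = sets (borel \<Otimes>\<^sub>M borel)" "prob_space \<gamma>"
    using assms by (auto simp: space_prob_algebra)
  have "continuous_on {0..1} (line z)" for z
  proof -
    have "continuous_on {0..1} (\<lambda>t. (1 - t) *\<^sub>R fst z + t *\<^sub>R snd z)"
      by (intro continuous_intros)
    then show ?thesis
      by (rule continuous_on_cong[THEN iffD1, rotated 2]) (auto simp: line_def)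
  qed
  then have "line \<in> borel \<Otimes>\<^sub>M borel \<rightarrow>\<^sub>M path_space"
    unfolding path_space_def
    by (intro measurable_restrict_space2 measurable_PiM_single') (auto simp: line_def)
  then have line[measurable]: "line \<in> \<gamma> \<rightarrow>\<^sub>M path_space"
    using \<gamma> by (simp cong: measurable_cong_sets)
  have "endpoint_law (distr \<gamma> path_space line) = distr \<gamma> (borel \<Otimes>\<^sub>M borel) (\<lambda>z. z)"
    unfolding endpoint_law_def distr_distr[OF measurable_endpoints line] comp_def
    by (simp add: line_def)
  also have "\<dots> = \<gamma>"
    using \<gamma>(1) by (intro distr_id2) simp
  finally have "endpoint_law (distr \<gamma> path_space line) = \<gamma>" .
  moreover have "distr \<gamma> path_space line \<in> space (prob_algebra path_space)"
    using \<gamma>(2) by (simp add: space_prob_algebra prob_space.prob_space_distr)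
  ultimately show ?thesis
    using that by blast
qed

subsection \<open>The endpoint law of Brownian motion\<close>

text \<open>The density of \<open>isotropic_gaussian 1\<close>, which is the transition density of
  Brownian motion over unit time.\<close>

definition gauss_density :: "real^'d \<Rightarrow> real" where
  "gauss_density z = (\<Prod>i\<in>UNIV. normal_density 0 1 (z $ i))"

lemma gauss_density_pos: "0 < gauss_density z"
  unfolding gauss_density_def by (intro prod_pos) (simp add: normal_density_pos)

lemma measurable_gauss_density [measurable]: "gauss_density \<in> borel_measurable borel"
  unfolding gauss_density_def by measurable

text \<open>The source of the quadratic cost: minus the log transition density over unit time is
  half the squared distance plus a constant. Unit variance corresponds to \<epsilon> = 1.\<close>

lemma ln_gauss_density:
  "ln (gauss_density (z :: real^'d)) = - (1/2 * (norm z)\<^sup>2) - real CARD('d) * (ln (2 * pi) / 2)"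
proof -
  have nz: "normal_density 0 1 x \<noteq> 0" for x
    using normal_density_pos[of 1 0 x] by simp
  have "ln (gauss_density z) = (\<Sum>i\<in>UNIV. ln (normal_density 0 1 (z $ i)))"
    unfolding gauss_density_def by (intro ln_prod nz) simp
  also have "\<dots> = (\<Sum>i\<in>UNIV. - (1/2 * (z $ i)\<^sup>2) - ln (2 * pi) / 2)"
    by (intro sum.cong refl) (simp add: std_normal_density_def ln_mult ln_sqrt ln_div power2_eq_square)
  also have "\<dots> = - (1/2 * (\<Sum>i\<in>UNIV. (z $ i)\<^sup>2)) - real CARD('d) * (ln (2 * pi) / 2)"
    by (simp add: sum_subtractf sum_negf flip: sum_divide_distrib)
  also have "(\<Sum>i\<in>UNIV. (z $ i)\<^sup>2) = (norm z)\<^sup>2"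
    by (simp add: norm_vec_def L2_set_def sum_nonneg)
  finally show ?thesis .
qed

text \<open>Almost surely \<omega> 1 = a + (\<omega> 1 - \<omega> 0), and the increment has the
  standard Gaussian law.\<close>

lemma endpoint_law_brownian:
  fixes W :: "(real \<Rightarrow> real^'d) measure"
  assumes "brownian_law a W"
  shows "endpoint_law W =
    distr (density lborel (\<lambda>z. ennreal (gauss_density z))) (borel \<Otimes>\<^sub>M borel) (\<lambda>z. (a, a + z))"
proof -
  have W: "sets W = sets path_space" "AE \<omega> in W. \<omega> 0 = a"
    and incr: "distr W borel (\<lambda>\<omega>. \<omega> 1 - \<omega> 0) = isotropic_gaussian 1"
    using assms by (auto simp: brownian_law_def space_prob_algebra)
  have [measurable]: "(\<lambda>\<omega>. \<omega> 0) \<in> W \<rightarrow>\<^sub>M borel" "(\<lambda>\<omega>. \<omega> 1) \<in> W \<rightarrow>\<^sub>M borel"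
    using measurable_path_eval W(1) by (simp_all cong: measurable_cong_sets)
  have "distr (isotropic_gaussian 1) (borel \<Otimes>\<^sub>M borel) (\<lambda>z. (a, a + z)) =
      distr W (borel \<Otimes>\<^sub>M borel) (\<lambda>\<omega>. (a, a + (\<omega> 1 - \<omega> 0)))"
    unfolding incr[symmetric] by (subst distr_distr) (simp_all add: comp_def)
  also have "\<dots> = endpoint_law W"
    unfolding endpoint_law_def using W(2) by (intro distr_cong_AE) (auto elim!: eventually_mono)
  finally show ?thesis
    by (simp add: isotropic_gaussian_def gauss_density_def)
qed

text \<open>For each start x, translation invariance of Lebesgue measure turns the law of x + z into
  a density in y = x + z. Integrating over x with Tonelli gives the joint density.\<close>

lemma endpoint_law_wiener_mixture:
  fixes \<mu> :: "(real^'d) measure"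
  assumes \<mu>: "\<mu> \<in> space (prob_algebra borel)" and W: "wiener_kernel W"
  shows "\<mu> \<bind> W \<in> space (prob_algebra path_space)"
    and "endpoint_law (\<mu> \<bind> W) = density (\<mu> \<Otimes>\<^sub>M lborel) (\<lambda>(x, y). ennreal (gauss_density (y - x)))"
proof -
  interpret \<mu>: prob_space \<mu>
    using \<mu> by (simp add: space_prob_algebra)
  have sets[measurable_cong]: "sets \<mu> = sets borel"
    using \<mu> by (simp add: space_prob_algebra)
  have Wm: "W \<in> borel \<rightarrow>\<^sub>M prob_algebra path_space" and bm: "brownian_law a (W a)" for a
    using W by (auto simp: wiener_kernel_def)
  then have Wm': "W \<in> \<mu> \<rightarrow>\<^sub>M prob_algebra path_space"
    using sets by (simp cong: measurable_cong_sets)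
  show R: "\<mu> \<bind> W \<in> space (prob_algebra path_space)"
    using \<mu> \<mu>.prob_space_bind[OF _ measurable_prob_algebraD[OF Wm']] measurable_space[OF Wm']
      measurable_space[OF Wm] \<mu>.not_empty
    by (simp add: space_prob_algebra)
  show "endpoint_law (\<mu> \<bind> W) = density (\<mu> \<Otimes>\<^sub>M lborel) (\<lambda>(x, y). ennreal (gauss_density (y - x)))"
  proof (rule measure_eqI)
    fix A assume "A \<in> sets (endpoint_law (\<mu> \<bind> W))"
    then have A[measurable]: "A \<in> sets (borel \<Otimes>\<^sub>M borel)"
      by (simp add: endpoint_law_def)
    have inner: "emeasure (endpoint_law (W x)) A =
        (\<integral>\<^sup>+y. ennreal (gauss_density (y - x)) * indicator A (x, y) \<partial>lborel)" for x
    proof -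
      have "(\<lambda>z. (x, x + z)) -` A \<in> sets borel"
        using measurable_sets[of "\<lambda>z. (x, x + z)" borel "borel \<Otimes>\<^sub>M borel" A] A by simp
      then have "emeasure (endpoint_law (W x)) A =
          (\<integral>\<^sup>+z. ennreal (gauss_density z) * indicator A (x, x + z) \<partial>lborel)"
        unfolding endpoint_law_brownian[OF bm]
        by (auto simp: emeasure_distr emeasure_density intro!: nn_integral_cong split: split_indicator)
      also have "\<dots> = (\<integral>\<^sup>+y. ennreal (gauss_density (y - x)) * indicator A (x, y) \<partial>distr lborel borel ((+) x))"
        by (subst nn_integral_distr) auto
      finally show ?thesis
        by (simp add: lborel_distr_plus)
    qed
    have "emeasure (endpoint_law (\<mu> \<bind> W)) A = (\<integral>\<^sup>+x. emeasure (endpoint_law (W x)) A \<partial>\<mu>)"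
      unfolding endpoint_law_def
      by (subst distr_bind[OF measurable_prob_algebraD[OF Wm'] \<mu>.not_empty measurable_endpoints],
          subst emeasure_bind[OF \<mu>.not_empty _ A])
        (auto intro!: measurable_compose[OF measurable_prob_algebraD[OF Wm']] measurable_distr)
    also have "\<dots> = (\<integral>\<^sup>+x. (\<integral>\<^sup>+y. ennreal (gauss_density (y - x)) * indicator A (x, y) \<partial>lborel) \<partial>\<mu>)"
      by (simp add: inner)
    also have "\<dots> = emeasure (density (\<mu> \<Otimes>\<^sub>M lborel) (\<lambda>(x, y). ennreal (gauss_density (y - x)))) A"
      by (subst emeasure_density, measurable)
        (simp add: lborel.nn_integral_fst[symmetric] split_beta')
    finally show "emeasure (endpoint_law (\<mu> \<bind> W)) A =
      emeasure (density (\<mu> \<Otimes>\<^sub>M lborel) (\<lambda>(x, y). ennreal (gauss_density (y - x)))) A" .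
  qed (simp add: endpoint_law_def sets cong: sets_pair_measure_cong)
qed

text \<open>The chain rule with \<mu> \<otimes> \<pi> as intermediate measure. Its log-density
  relative to \<open>E\<close> is the cost plus a constant plus ln p(y), and the last term has the
  same integral for every coupling because the second marginal is fixed. \<open>ent\<close> makes
  that integral a real number.\<close>

lemma KL_eq_eot_objective_add:
  fixes \<mu> \<pi> :: "(real^'d) measure"
  assumes \<mu>: "\<mu> \<in> space (prob_algebra borel)" and \<pi>: "\<pi> \<in> space (prob_algebra borel)"
    and ac\<pi>: "absolutely_continuous lborel \<pi>"
    and ent: "integrable \<pi> (entropy_density (exp 1) lborel \<pi>)"
    and E: "E = density (\<mu> \<Otimes>\<^sub>M lborel) (\<lambda>(x, y). ennreal (gauss_density (y - x)))" "prob_space E"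
    and \<gamma>: "\<gamma> \<in> couplings \<mu> \<pi>"
  shows "KL \<gamma> E = eot_objective 1 \<mu> \<pi> \<gamma> +
    ereal (KL_divergence (exp 1) lborel \<pi> + real CARD('d) * (ln (2 * pi) / 2))"
proof -
  interpret \<mu>: prob_space \<mu>
    using \<mu> by (simp add: space_prob_algebra)
  interpret \<pi>: prob_space \<pi>
    using \<pi> by (simp add: space_prob_algebra)
  interpret \<gamma>: prob_space \<gamma>
    using \<gamma> by (simp add: couplings_def space_prob_algebra)
  interpret E: prob_space E by fact
  interpret PL: pair_sigma_finite \<mu> "lborel :: (real^'d) measure" ..
  interpret PP: pair_prob_space \<mu> \<pi> ..
  have sets[measurable_cong]: "sets \<mu> = sets borel" "sets \<pi> = sets borel"
      "sets \<gamma> = sets (borel \<Otimes>\<^sub>M borel)"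
    and marg: "distr \<gamma> borel snd = \<pi>"
    using \<mu> \<pi> \<gamma> by (auto simp: space_prob_algebra couplings_def)
  have setsE[measurable_cong]: "sets E = sets (borel \<Otimes>\<^sub>M borel)"
    using sets by (simp add: E cong: sets_pair_measure_cong)
  have sets\<mu>\<pi>[measurable_cong]: "sets (\<mu> \<Otimes>\<^sub>M \<pi>) = sets (borel \<Otimes>\<^sub>M borel)"
    using sets by (simp cong: sets_pair_measure_cong)
  obtain p :: "real^'d \<Rightarrow> real" where p[measurable]: "p \<in> borel_measurable lborel" and p0: "\<And>y. 0 \<le> p y"
    and \<pi>p: "\<pi> = density lborel (\<lambda>y. ennreal (p y))"
    using real_density_exists[OF lborel.sigma_finite_measure_axioms \<pi>.finite_measure_axioms ac\<pi>] sets
    by (metis sets_lborel)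
  have p'[measurable]: "p \<in> borel_measurable borel"
    using p by simp
  have ed\<pi>: "AE y in \<pi>. entropy_density (exp 1) lborel \<pi> y = ln (p y) \<and> 0 < p y"
    by (rule entropy_density_density[OF lborel.sigma_finite_measure_axioms p p0 \<pi>p])
  have [measurable]: "entropy_density (exp 1) lborel \<pi> \<in> borel_measurable borel"
    using measurable_entropy_density[of "exp 1" lborel \<pi>] by simp
  have int\<pi>: "integrable \<pi> (\<lambda>y. ln (p y))"
    and KL\<pi>: "(\<integral>y. ln (p y) \<partial>\<pi>) = KL_divergence (exp 1) lborel \<pi>"
  proof -
    show "integrable \<pi> (\<lambda>y. ln (p y))"
      using ent ed\<pi> by (subst integrable_cong_AE[where g = "entropy_density (exp 1) lborel \<pi>"]) auto
    show "(\<integral>y. ln (p y) \<partial>\<pi>) = KL_divergence (exp 1) lborel \<pi>"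
      unfolding KL_divergence_def using ed\<pi> by (intro integral_cong_AE) auto
  qed
  have snd_meas[measurable]: "snd \<in> \<gamma> \<rightarrow>\<^sub>M borel"
    by measurable
  have int\<gamma>: "integrable \<gamma> (\<lambda>z. ln (p (snd z)))"
    and int\<gamma>_eq: "(\<integral>z. ln (p (snd z)) \<partial>\<gamma>) = KL_divergence (exp 1) lborel \<pi>"
    using int\<pi> KL\<pi> integrable_distr_eq[OF snd_meas, of "\<lambda>y. ln (p y)"]
      integral_distr[OF snd_meas, of "\<lambda>y. ln (p y)"] by (simp_all add: marg)
  have p_pos: "AE z in \<gamma>. 0 < p (snd z)"
  proof -
    have "AE y in distr \<gamma> borel snd. 0 < p y"
      using ed\<pi> unfolding marg by (rule eventually_mono) auto
    then show ?thesis
      by (subst (asm) AE_distr_iff) simp_all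
  qed
  define q where "q z = p (snd z) / gauss_density (snd z - fst z)" for z :: "(real^'d) \<times> (real^'d)"
  have q[measurable]: "q \<in> borel_measurable (borel \<Otimes>\<^sub>M borel)"
    unfolding q_def by measurable
  have q0: "0 \<le> q z" for z
    unfolding q_def by (intro divide_nonneg_pos p0 gauss_density_pos)
  have \<mu>\<pi>_density: "\<mu> \<Otimes>\<^sub>M \<pi> = density (\<mu> \<Otimes>\<^sub>M lborel) (\<lambda>z. ennreal (p (snd z)))"
  proof -
    have "density \<mu> (\<lambda>_. 1) \<Otimes>\<^sub>M density lborel (\<lambda>y. ennreal (p y)) =
        density (\<mu> \<Otimes>\<^sub>M lborel) (\<lambda>(x, y). 1 * ennreal (p y))"
      by (rule pair_measure_density)
        (use \<pi>.sigma_finite_measure_axioms in \<open>auto simp: \<pi>p lborel.sigma_finite_measure_axioms\<close>)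
    then show ?thesis
      by (simp add: density_1 \<pi>p split_beta')
  qed
  have \<mu>\<pi>: "\<mu> \<Otimes>\<^sub>M \<pi> = density E (\<lambda>z. ennreal (q z))"
  proof -
    have "density E (\<lambda>z. ennreal (q z)) =
        density (\<mu> \<Otimes>\<^sub>M lborel) (\<lambda>z. ennreal (gauss_density (snd z - fst z)) * ennreal (q z))"
      unfolding E(1) split_beta' by (subst density_density_eq) measurable
    also have "(\<lambda>z. ennreal (gauss_density (snd z - fst z)) * ennreal (q z)) = (\<lambda>z. ennreal (p (snd z)))"
    proof
      fix z :: "(real^'d) \<times> (real^'d)"
      show "ennreal (gauss_density (snd z - fst z)) * ennreal (q z) = ennreal (p (snd z))"
        using gauss_density_pos[of "snd z - fst z"] q0[of z] by (simp add: q_def flip: ennreal_mult')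
    qed
    finally show ?thesis
      by (simp add: \<mu>\<pi>_density)
  qed
  define b where "b = real CARD('d) * (ln (2 * pi) / 2)"
  let ?cost = "\<lambda>z :: (real^'d) \<times> (real^'d). 1/2 * (norm (fst z - snd z))\<^sup>2"
  have b0: "0 \<le> b"
    unfolding b_def using pi_gt3 by (intro mult_nonneg_nonneg divide_nonneg_nonneg ln_ge_zero) auto
  have ln_q: "AE z in \<gamma>. ln (q z) = ln (p (snd z)) + (?cost z + b)"
    using p_pos
  proof eventually_elim
    case (elim z)
    then show ?case
      using gauss_density_pos[of "snd z - fst z"]
      by (simp add: q_def ln_div ln_gauss_density b_def norm_minus_commute)
  qed
  have ac_iff: "absolutely_continuous E \<gamma> \<longleftrightarrow> absolutely_continuous (\<mu> \<Otimes>\<^sub>M \<pi>) \<gamma>"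
  proof
    assume "absolutely_continuous (\<mu> \<Otimes>\<^sub>M \<pi>) \<gamma>"
    moreover have "absolutely_continuous E (\<mu> \<Otimes>\<^sub>M \<pi>)"
      unfolding \<mu>\<pi> by (rule absolutely_continuousI_density) measurable
    ultimately show "absolutely_continuous E \<gamma>"
      by (rule absolutely_continuous_trans[rotated])
  next
    \<comment> \<open>The density \<open>q\<close> vanishes exactly where \<open>p (snd z)\<close>
      does, and \<gamma> does not charge that set since its second marginal is \<pi>.\<close>
    assume ac: "absolutely_continuous E \<gamma>"
    show "absolutely_continuous (\<mu> \<Otimes>\<^sub>M \<pi>) \<gamma>"
      unfolding absolutely_continuous_def
    proof
      fix A assume "A \<in> null_sets (\<mu> \<Otimes>\<^sub>M \<pi>)"
      then have A: "A \<in> sets E" "AE z in E. z \<in> A \<longrightarrow> ennreal (q z) = 0"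
        unfolding \<mu>\<pi> by (auto simp: null_sets_density_iff)
      have "AE z in \<gamma>. z \<in> A \<longrightarrow> ennreal (q z) = 0"
        by (rule absolutely_continuous_AE[OF _ ac A(2)]) (simp add: sets setsE)
      with p_pos have "AE z in \<gamma>. z \<notin> A"
        by eventually_elim (auto simp: q_def ennreal_eq_0_iff divide_le_0_iff not_le gauss_density_pos
            dest: order.strict_trans1[OF _ gauss_density_pos])
      then show "A \<in> null_sets \<gamma>"
        using A by (subst AE_iff_null_sets) (auto simp: sets setsE)
    qed
  qed
  have cost: "(if integrable \<gamma> (\<lambda>z. ln (q z)) then ereal (\<integral>z. ln (q z) \<partial>\<gamma>) else \<infinity>) =
      enn2ereal (\<integral>\<^sup>+z. ennreal (?cost z) \<partial>\<gamma>) + ereal (KL_divergence (exp 1) lborel \<pi> + b)"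
  proof -
    have "integrable \<gamma> (\<lambda>z. ln (q z)) \<longleftrightarrow> integrable \<gamma> (\<lambda>z. ln (p (snd z)) + (?cost z + b))"
      using ln_q by (intro integrable_cong_AE) auto
    also have "\<dots> \<longleftrightarrow> integrable \<gamma> ?cost"
    proof
      assume *: "integrable \<gamma> (\<lambda>z. ln (p (snd z)) + (?cost z + b))"
      have "integrable \<gamma> (\<lambda>z. ln (p (snd z)) + (?cost z + b) - ln (p (snd z)) - b)"
        by (intro Bochner_Integration.integrable_diff * int\<gamma>) auto
      then show "integrable \<gamma> ?cost" by simp
    qed (intro Bochner_Integration.integrable_add int\<gamma>, auto)
    finally have iff: "integrable \<gamma> (\<lambda>z. ln (q z)) \<longleftrightarrow> integrable \<gamma> ?cost" .
    show ?thesis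
    proof (cases "integrable \<gamma> ?cost")
      case True
      have "(\<integral>z. ln (q z) \<partial>\<gamma>) = (\<integral>z. ln (p (snd z)) + (?cost z + b) \<partial>\<gamma>)"
        using ln_q by (intro integral_cong_AE) auto
      also have "\<dots> = KL_divergence (exp 1) lborel \<pi> + ((\<integral>z. ?cost z \<partial>\<gamma>) + b)"
        using True int\<gamma> by (simp add: int\<gamma>_eq \<gamma>.prob_space del: integral_mult_right_zero)
      moreover have "(\<integral>\<^sup>+z. ennreal (?cost z) \<partial>\<gamma>) = ennreal (\<integral>z. ?cost z \<partial>\<gamma>)"
        by (intro nn_integral_eq_integral True) auto
      ultimately show ?thesis
        using True by (simp add: iff enn2ereal_ennreal)
    next
      case False
      \<comment> \<open>The cost is nonnegative and measurable, so failing to be integrable means an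
        infinite transport term.\<close>
      then have "(\<integral>\<^sup>+z. ennreal (?cost z) \<partial>\<gamma>) = \<infinity>"
        by (subst (asm) integrable_iff_bounded) (simp add: less_top[symmetric])
      then show ?thesis
        using False by (simp add: iff)
    qed
  qed
  show ?thesis
  proof (cases "absolutely_continuous E \<gamma>")
    case True
    \<comment> \<open>Because 2 pi > 1, \<open>b\<close> is nonnegative, and so is the cost. Thus
      \<open>ln (q z)\<close> is at least \<open>ln (p (snd z))\<close>, whose absolute value is
      integrable and bounds the negative part.\<close>
    have "integrable \<gamma> (\<lambda>z. max 0 (- ln (q z)))"
    proof (rule Bochner_Integration.integrable_bound[OF integrable_abs[OF int\<gamma>]])
      show "AE z in \<gamma>. norm (max 0 (- ln (q z))) \<le> norm \<bar>ln (p (snd z))\<bar>"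
        using ln_q
      proof eventually_elim
        case (elim z)
        moreover have "0 \<le> ?cost z + b" using b0 by simp
        ultimately show ?case by (auto simp: max_def)
      qed
    qed measurable
    then have "KL \<gamma> E = KL \<gamma> (\<mu> \<Otimes>\<^sub>M \<pi>) +
        (if integrable \<gamma> (\<lambda>z. ln (q z)) then ereal (\<integral>z. ln (q z) \<partial>\<gamma>) else \<infinity>)"
      using True
      by (intro KL_density_chain[OF E(2) PP.prob_space_axioms \<gamma>.prob_space_axioms _ _ q0 \<mu>\<pi>])
        (auto simp: sets setsE ac_iff)
    also have "\<dots> = eot_objective 1 \<mu> \<pi> \<gamma> + ereal (KL_divergence (exp 1) lborel \<pi> + b)"
      unfolding cost eot_objective_def split_beta' one_ereal_def[symmetric] by (simp add: ac_simps)
    finally show ?thesis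
      by (simp add: b_def)
  next
    case False
    \<comment> \<open>By \<open>ac_iff\<close> both divergences are infinite, and the nonnegative
      transport term keeps the objective at infinity.\<close>
    then show ?thesis
      by (simp add: KL_def eot_objective_def ac_iff one_ereal_def[symmetric] del: plus_ereal.simps)
  qed
qed

subsection \<open>Minimisation along fibres\<close>

text \<open>To be read with \<open>A\<close> the bridges, \<open>B\<close> the couplings and
  \<open>e\<close> the endpoint law. \<open>F\<close> is the divergence of path laws and
  \<open>f\<close> that of endpoint laws, \<open>le\<close> is data processing and
  \<open>lift\<close> comes from the tilt.\<close>

context
  fixes F :: "'a \<Rightarrow> ereal" and f :: "'b \<Rightarrow> ereal" and e :: "'a \<Rightarrow> 'b" and A :: "'a set" and B :: "'b set"
  assumes e: "e ` A \<subseteq> B" and le: "\<And>x. x \<in> A \<Longrightarrow> f (e x) \<le> F x"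
    and lift: "\<And>y. y \<in> B \<Longrightarrow> \<exists>x\<in>A. e x = y \<and> F x = f y"
begin

lemma fibre_INF: "y \<in> B \<Longrightarrow> (INF x\<in>{x \<in> A. e x = y}. F x) = f y"
  using lift[of y] le by (intro antisym INF_greatest) (auto intro: INF_lower2)

lemma total_INF: "(INF x\<in>A. F x) = (INF y\<in>B. f y)"
proof (rule antisym)
  show "(INF x\<in>A. F x) \<le> (INF y\<in>B. f y)"
    by (rule INF_greatest) (metis lift INF_lower)
  show "(INF y\<in>B. f y) \<le> (INF x\<in>A. F x)"
    using e le by (intro INF_greatest) (meson INF_lower2 image_subset_iff)
qed

text \<open>Otherwise the lift of \<open>e x\<close> would have a smaller value than
  \<open>x\<close>.\<close>

lemma minimizer_eq:
  assumes "x \<in> minimizers F A" shows "F x = f (e x)"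
proof -
  have x: "x \<in> A" "\<And>x'. x' \<in> A \<Longrightarrow> F x \<le> F x'"
    using assms by (auto simp: minimizers_def is_arg_min_def not_less)
  obtain x' where "x' \<in> A" "F x' = f (e x)"
    using lift[of "e x"] e x(1) by auto
  then show ?thesis
    using x le[of x] by (metis antisym)
qed

text \<open>Every y lifts to a competitor of value \<open>f y\<close>, so minimizers are mapped to
  minimizers. Conversely the lift of a minimizer y is one, since f y \<le> f (e x') \<le> F x'.
  Infinite values are covered too.\<close>

lemma image_minimizers: "e ` minimizers F A = minimizers f B"
proof
  show "e ` minimizers F A \<subseteq> minimizers f B"
  proof safe
    fix x assume *: "x \<in> minimizers F A"
    then have x: "x \<in> A" "\<And>x'. x' \<in> A \<Longrightarrow> F x \<le> F x'"
      by (auto simp: minimizers_def is_arg_min_def not_less)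
    have "f (e x) \<le> f y" if "y \<in> B" for y
      using lift[OF that] x minimizer_eq[OF *] by metis
    then show "e x \<in> minimizers f B"
      using e x(1) by (auto simp: minimizers_def is_arg_min_def not_less)
  qed
  show "minimizers f B \<subseteq> e ` minimizers F A"
  proof
    fix y assume "y \<in> minimizers f B"
    then have y: "y \<in> B" "\<And>y'. y' \<in> B \<Longrightarrow> f y \<le> f y'"
      by (auto simp: minimizers_def is_arg_min_def not_less)
    obtain x where x: "x \<in> A" "e x = y" "F x = f y"
      using lift[OF y(1)] by auto
    have "F x \<le> F x'" if "x' \<in> A" for x'
      using y(2)[of "e x'"] le[OF that] e that x by (auto intro: order_trans)
    then show "y \<in> e ` minimizers F A"
      using x by (auto simp: minimizers_def is_arg_min_def not_less intro!: image_eqI[of _ _ x])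
  qed
qed

end

section \<open>Constant shifts and the equivalence of the two problems\<close>

lemma INF_add_ereal:
  fixes f :: "'a \<Rightarrow> ereal" and c :: real
  shows "(INF x\<in>A. f x + ereal c) = (INF x\<in>A. f x) + ereal c"
proof (rule antisym)
  have "(INF x\<in>A. f x + ereal c) - ereal c \<le> (INF x\<in>A. f x)"
    by (intro INF_greatest) (auto simp: ereal_minus_le intro: INF_lower)
  then show "(INF x\<in>A. f x + ereal c) \<le> (INF x\<in>A. f x) + ereal c"
    by (simp add: ereal_minus_le)
  show "(INF x\<in>A. f x) + ereal c \<le> (INF x\<in>A. f x + ereal c)"
    by (intro INF_greatest add_right_mono INF_lower)
qed

lemma minimizers_add_ereal: "minimizers (\<lambda>x. f x + ereal c) A = minimizers f A"
proof -
  have "a + ereal c < b + ereal c \<longleftrightarrow> a < b" for a b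
    by (cases a; cases b) auto
  then show ?thesis
    by (simp add: minimizers_def is_arg_min_def)
qed

text \<open>The problems have different variables, so they are compared through the endpoint law:
  minimising over the path laws with given endpoints must leave the transport objective up to a
  shift. Quantifying \<open>c\<close> before \<open>W\<close> makes the shift depend on \<mu> and
  \<pi> alone.\<close>

theorem theorem7:
  fixes \<mu> \<pi> :: "(real^'d) measure"
  assumes "\<mu> \<in> space (prob_algebra borel)" and "\<pi> \<in> space (prob_algebra borel)"
    and "absolutely_continuous lborel \<mu>" and "absolutely_continuous lborel \<pi>"
    and finite_entropy: "integrable \<pi> (entropy_density (exp 1) lborel \<pi>)"
  shows "\<exists>c::real. \<forall>W. wiener_kernel W \<longrightarrow>
    (let R = \<mu> \<bind> W in
      endpoint_law ` bridges \<mu> \<pi> = couplings \<mu> \<pi> \<and>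
      (\<forall>\<gamma>\<in>couplings \<mu> \<pi>.
        (INF P\<in>{P \<in> bridges \<mu> \<pi>. endpoint_law P = \<gamma>}. KL P R) = eot_objective 1 \<mu> \<pi> \<gamma> + ereal c) \<and>
      (INF P\<in>bridges \<mu> \<pi>. KL P R) = (INF \<gamma>\<in>couplings \<mu> \<pi>. eot_objective 1 \<mu> \<pi> \<gamma>) + ereal c \<and>
      endpoint_law ` minimizers (\<lambda>P. KL P R) (bridges \<mu> \<pi>) =
        minimizers (eot_objective 1 \<mu> \<pi>) (couplings \<mu> \<pi>) \<and>
      ((INF P\<in>bridges \<mu> \<pi>. KL P R) < \<infinity> \<longrightarrow>
        inj_on endpoint_law (minimizers (\<lambda>P. KL P R) (bridges \<mu> \<pi>))))"
proof -
  \<comment> \<open>The integral of p log p, with p the density of \<pi>, plus the logarithm of the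
    Gaussian normalising constant.\<close>
  define c where "c = KL_divergence (exp 1) lborel \<pi> + real CARD('d) * (ln (2 * pi) / 2)"
  let ?B = "bridges \<mu> \<pi>" and ?C = "couplings \<mu> \<pi>"
  have main: "endpoint_law ` ?B = ?C \<and>
      (\<forall>\<gamma>\<in>?C. (INF P\<in>{P \<in> ?B. endpoint_law P = \<gamma>}. KL P R) = eot_objective 1 \<mu> \<pi> \<gamma> + ereal c) \<and>
      (INF P\<in>?B. KL P R) = (INF \<gamma>\<in>?C. eot_objective 1 \<mu> \<pi> \<gamma>) + ereal c \<and>
      endpoint_law ` minimizers (\<lambda>P. KL P R) ?B = minimizers (eot_objective 1 \<mu> \<pi>) ?C \<and>
      ((INF P\<in>?B. KL P R) < \<infinity> \<longrightarrow> inj_on endpoint_law (minimizers (\<lambda>P. KL P R) ?B))"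
    if W: "wiener_kernel W" and R_def: "R = \<mu> \<bind> W" for W R
  proof -
    have R: "R \<in> space (prob_algebra path_space)"
      and E: "endpoint_law R = density (\<mu> \<Otimes>\<^sub>M lborel) (\<lambda>(x, y). ennreal (gauss_density (y - x)))"
      unfolding R_def using endpoint_law_wiener_mixture[OF assms(1) W] by auto
    then have R_prob: "prob_space R" and setsR: "sets R = sets path_space"
      by (auto simp: space_prob_algebra)
    have T: "(\<lambda>\<omega>. (\<omega> 0, \<omega> 1)) \<in> R \<rightarrow>\<^sub>M borel \<Otimes>\<^sub>M borel"
      using measurable_endpoints setsR by (simp cong: measurable_cong_sets)
    have "prob_space (endpoint_law R)"
      unfolding endpoint_law_def by (rule prob_space.prob_space_distr[OF R_prob T])
    then have KL_E: "KL \<gamma> (endpoint_law R) = eot_objective 1 \<mu> \<pi> \<gamma> + ereal c" if "\<gamma> \<in> ?C" for \<gamma>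
      unfolding c_def using KL_eq_eot_objective_add[OF assms(1,2,4,5) E _ that] by simp
    have bridgeD: "prob_space P" "sets P = sets R" "endpoint_law P \<in> ?C" if "P \<in> ?B" for P
      using that endpoint_law_in_couplings_iff[of P \<mu> \<pi>]
      by (auto simp: bridges_def space_prob_algebra setsR)
    have sub: "endpoint_law ` ?B \<subseteq> ?C"
      using bridgeD(3) by auto
    have le: "KL (endpoint_law P) (endpoint_law R) \<le> KL P R" if "P \<in> ?B" for P
      unfolding endpoint_law_def using bridgeD[OF that] by (intro KL_distr_le[OF R_prob _ _ T])
    have lift: "\<exists>P\<in>?B. endpoint_law P = \<gamma> \<and> KL P R = KL \<gamma> (endpoint_law R)" if \<gamma>: "\<gamma> \<in> ?C" for \<gamma>
    proof (cases "absolutely_continuous (endpoint_law R) \<gamma>")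
      case True
      have N: "prob_space \<gamma>" "sets \<gamma> = sets (borel \<Otimes>\<^sub>M borel)"
        using \<gamma> by (auto simp: couplings_def space_prob_algebra)
      note tilt = R_prob T N True[unfolded endpoint_law_def]
      let ?P = "tilt R (borel \<Otimes>\<^sub>M borel) (\<lambda>\<omega>. (\<omega> 0, \<omega> 1)) \<gamma>"
      have "endpoint_law ?P = \<gamma>"
        unfolding endpoint_law_def by (rule distr_tilt[OF tilt])
      moreover have "?P \<in> space (prob_algebra path_space)"
        using prob_space_tilt[OF tilt] sets_tilt[OF tilt] setsR by (simp add: space_prob_algebra)
      ultimately show ?thesis
        using KL_tilt[OF tilt] \<gamma> endpoint_law_in_couplings_iff[of ?P \<mu> \<pi>]
        by (intro bexI[of _ ?P]) (auto simp: endpoint_law_def)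
    next
      case False
      \<comment> \<open>Any bridge with endpoint law \<gamma> will do: data processing forces its
        divergence to be infinite as well.\<close>
      obtain P where P: "P \<in> space (prob_algebra path_space)" "endpoint_law P = \<gamma>"
        using exists_path_law_with_endpoints[of \<gamma>] \<gamma> by (auto simp: couplings_def)
      then have "P \<in> ?B"
        using \<gamma> endpoint_law_in_couplings_iff[of P \<mu> \<pi>] by simp
      moreover have "KL \<gamma> (endpoint_law R) = \<infinity>"
        using False by (simp add: KL_def)
      ultimately show ?thesis
        using P le[of P] by (intro bexI[of _ P]) auto
    qed
    note reduction = sub le lift
    have inj: "inj_on endpoint_law (minimizers (\<lambda>P. KL P R) ?B)" if fin: "(INF P\<in>?B. KL P R) < \<infinity>"
    proof (rule inj_onI)
      \<comment> \<open>A minimizer of finite value attains the data processing bound, hence is the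
        tilt determined by its endpoint law. If the infimum were infinite, every bridge would be a
        minimizer.\<close>
      have *: "P = tilt R (borel \<Otimes>\<^sub>M borel) (\<lambda>\<omega>. (\<omega> 0, \<omega> 1)) (endpoint_law P)"
        if P: "P \<in> minimizers (\<lambda>P. KL P R) ?B" for P
      proof -
        have "P \<in> ?B" and min: "\<And>Q. Q \<in> ?B \<Longrightarrow> KL P R \<le> KL Q R"
          using P by (auto simp: minimizers_def is_arg_min_def not_less)
        moreover obtain Q where "Q \<in> ?B" "KL Q R < \<infinity>"
          using fin unfolding INF_less_iff by blast
        then have "KL P R < \<infinity>"
          using min by (blast intro: le_less_trans)
        ultimately show ?thesis
          using minimizer_eq[OF reduction P] bridgeD[of P]
          unfolding endpoint_law_def by (intro KL_distr_eqD[OF R_prob _ _ T])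
      qed
      fix P P' assume "P \<in> minimizers (\<lambda>P. KL P R) ?B" "P' \<in> minimizers (\<lambda>P. KL P R) ?B"
        "endpoint_law P = endpoint_law P'"
      then show "P = P'"
        using *[of P] *[of P'] by simp
    qed
    have "endpoint_law ` ?B = ?C"
      using sub lift by blast
    moreover have "(INF P\<in>{P \<in> ?B. endpoint_law P = \<gamma>}. KL P R) = eot_objective 1 \<mu> \<pi> \<gamma> + ereal c"
      if "\<gamma> \<in> ?C" for \<gamma>
      using fibre_INF[OF reduction that] KL_E[OF that] by simp
    moreover have "(INF P\<in>?B. KL P R) = (INF \<gamma>\<in>?C. eot_objective 1 \<mu> \<pi> \<gamma>) + ereal c"
      using total_INF[OF reduction] KL_E by (simp add: INF_add_ereal cong: INF_cong_simp)
    moreover have "minimizers (\<lambda>\<gamma>. KL \<gamma> (endpoint_law R)) ?C = minimizers (eot_objective 1 \<mu> \<pi>) ?C"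
      unfolding minimizers_add_ereal[of "eot_objective 1 \<mu> \<pi>" c, symmetric]
      by (auto simp: minimizers_def is_arg_min_def KL_E)
    ultimately show ?thesis
      using image_minimizers[OF reduction] inj by simp
  qed
  show ?thesis
    unfolding Let_def by (intro exI[of _ c] allI impI) (rule main, auto)
qed

end
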